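(* Let $X$ be a finite-dimensional real vector space and $C \subseteq X$ a convex set. For any non-empty face $F$ of $C$ there is an affine lexicographic map $\phi : X \to (Y, Y_+)$ such that $\phi(C) \ge 0$ and $F = C \cap \ker \phi$.
   Context: A convex cone contains the origin and is closed under addition and under multiplication by positive scalars; it is pointed if $K \cap (-K) = \{0\}$. An oriented affine map $f: X \to (Y,Y_+)$ is an affine map from $X$ to a real vector space $Y$ equipped with a pointed convex cone $Y_+ \subseteq Y$, which defines the partial order $y \le y' \iff y'-y \in Y_+$; $f(S) \ge 0$ means $f(S) \subseteq Y_+$ (one says $f$ is positive on $S$); $\ker f := f^{-1}(0)$. A face of a convex set $C \subseteq X$ is a set of the form $C \cap \ker f$ for some oriented affine map $f$ on $X$ that is positive on $C$. Lexicographic product: for oriented affine maps $\phi_1: X \to (Y_1, Y_{1+})$, $\phi_2 : X \to (Y_2, Y_{2+})$, the oriented affine map $\phi_1 \rtimes \phi_2 : X \to (Y_1 \times Y_2, Y_+)$ is $x \mapsto (\phi_1(x), \phi_2(x))$ with $Y_+ := ((Y_{1+} \setminus \{0\}) \times Y_2) \cup (\{0\} \times Y_{2+})$. This operation is associative. An affine lexicographic map is a product $\phi = \psi_1 \rtimes \cdots \rtimes \psi_m$ with $m \ge 0$ of affine functionals $\psi_i : X \to (\mathbb{R}, \mathbb{R}_+)$, where each $\psi_i$ is non-constant on $\bigcap_{j<i} \ker \psi_j$ (the empty intersection being $X$); so its codomain is $\mathbb{R}^m$ with the lexicographic order. For $m = 0$ it is the zero map $X \to (\{0\},\{0\})$.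 *)

theory Defs
  imports "HOL-Analysis.Analysis" "HOL-Analysis.Finite_Function_Topology"
begin

subsection \<open>Oriented affine maps and faces\<close>

definition pointed_convex_cone :: "'b::real_vector set \<Rightarrow> bool" where
  "pointed_convex_cone K \<longleftrightarrow> convex_cone K \<and> K \<inter> uminus ` K = {0}"

definition affine_map :: "('a::real_vector \<Rightarrow> 'b::real_vector) \<Rightarrow> bool" where
  "affine_map f \<longleftrightarrow> (\<exists>g c. linear g \<and> f = (\<lambda>x. g x + c))"

definition oriented_affine_map ::
    "('a::real_vector \<Rightarrow> 'b::real_vector) \<Rightarrow> 'b set \<Rightarrow> bool" where
  "oriented_affine_map f K \<longleftrightarrow> affine_map f \<and> pointed_convex_cone K"

definition affine_ker :: "('a \<Rightarrow> 'b::zero) \<Rightarrow> 'a set" where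
  "affine_ker f = f -` {0}"

text \<open>
  The codomain of the map defining a face may be any real vector space. HOL cannot
  quantify over types inside a formula, so the codomain type is a parameter. In a theorem
  that assumes \<open>is_face TYPE('b) C F\<close> with a type variable \<open>'b\<close>, this variable is universally
  quantified, which covers faces with respect to maps into arbitrary real vector spaces.
\<close>

definition is_face ::
    "'b::real_vector itself \<Rightarrow> 'a::real_vector set \<Rightarrow> 'a set \<Rightarrow> bool" where
  "is_face _ C F \<longleftrightarrow>
     (\<exists>(f :: 'a \<Rightarrow> 'b) K. oriented_affine_map f K \<and> f ` C \<subseteq> K \<and> F = C \<inter> affine_ker f)"

subsection \<open>Lexicographic products\<close>

definition lex_prod_map :: "('a \<Rightarrow> 'b) \<Rightarrow> ('a \<Rightarrow> 'c) \<Rightarrow> 'a \<Rightarrow> 'b \<times> 'c" where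
  "lex_prod_map f g = (\<lambda>x. (f x, g x))"

definition lex_prod_cone :: "'b::zero set \<Rightarrow> 'c::zero set \<Rightarrow> ('b \<times> 'c) set" where
  "lex_prod_cone K L = ((K - {0}) \<times> UNIV) \<union> ({0} \<times> L)"

text \<open>
  An \<open>m\<close>-fold product has codomain \<open>\<real>\<^sup>m\<close>, where \<open>m\<close> varies and so cannot be part of a type.
  We represent \<open>\<real>\<^sup>m\<close> as the subspace of those \<open>y :: nat \<Rightarrow>\<^sub>0 real\<close> with
  \<open>Poly_Mapping.keys y \<subseteq> {..<m}\<close>. The function \<open>append_coord m\<close> is then the identification of
  \<open>\<real>\<^sup>m \<times> \<real>\<close> with \<open>\<real>\<^sup>m\<^sup>+\<^sup>1\<close>, and products are bracketed to the left.
\<close>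

definition append_coord :: "nat \<Rightarrow> (nat \<Rightarrow>\<^sub>0 real) \<times> real \<Rightarrow> (nat \<Rightarrow>\<^sub>0 real)" where
  "append_coord m = (\<lambda>(y, t). y + Poly_Mapping.single m t)"

primrec lex_map :: "(nat \<Rightarrow> 'a \<Rightarrow> real) \<Rightarrow> nat \<Rightarrow> 'a \<Rightarrow> (nat \<Rightarrow>\<^sub>0 real)" where
  "lex_map \<psi> 0 = (\<lambda>x. 0)"
| "lex_map \<psi> (Suc m) = append_coord m \<circ> lex_prod_map (lex_map \<psi> m) (\<psi> m)"

primrec lex_cone :: "nat \<Rightarrow> (nat \<Rightarrow>\<^sub>0 real) set" where
  "lex_cone 0 = {0}"
| "lex_cone (Suc m) = append_coord m ` lex_prod_cone (lex_cone m) {0..}"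

definition affine_lex_map ::
    "('a::real_vector \<Rightarrow> (nat \<Rightarrow>\<^sub>0 real)) \<Rightarrow> (nat \<Rightarrow>\<^sub>0 real) set \<Rightarrow> bool" where
  "affine_lex_map \<phi> K \<longleftrightarrow>
     (\<exists>m \<psi>. (\<forall>i<m. affine_map (\<psi> i) \<and> \<not> \<psi> i constant_on (\<Inter>j<i. affine_ker (\<psi> j))) \<and>
            \<phi> = lex_map \<psi> m \<and> K = lex_cone m)"

subsection \<open>The representation agrees with the lexicographic order on \<open>\<real>\<^sup>m\<close>\<close>

lemma lookup_lex_map:
  "Poly_Mapping.lookup (lex_map \<psi> m x) i = (if i < m then \<psi> i x else 0)"
  by (induction m)
     (auto simp: append_coord_def lex_prod_map_def lookup_add lookup_single when_def less_Suc_eq)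

lemma affine_ker_lex_map: "affine_ker (lex_map \<psi> m) = (\<Inter>i<m. affine_ker (\<psi> i))"
  by (auto simp: affine_ker_def poly_mapping_eq_iff fun_eq_iff lookup_lex_map split: if_splits)

lemma lex_cone_iff:
  "y \<in> lex_cone m \<longleftrightarrow> Poly_Mapping.keys y \<subseteq> {..<m} \<and>
     (y = 0 \<or> (\<exists>k<m. (\<forall>i<k. Poly_Mapping.lookup y i = 0) \<and> 0 < Poly_Mapping.lookup y k))"
proof (induction m arbitrary: y)
  case 0
  show ?case by auto
next
  case (Suc m)
  let ?l = "Poly_Mapping.lookup :: (nat \<Rightarrow>\<^sub>0 real) \<Rightarrow> _"
  have keys: "Poly_Mapping.keys z \<subseteq> {..<n} \<longleftrightarrow> (\<forall>i\<ge>n. ?l z i = 0)" for z n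
    by (auto simp: in_keys_iff subset_iff) (meson leI)
  have eq0: "z = 0 \<longleftrightarrow> (\<forall>i. ?l z i = 0)" for z
    by (auto simp: poly_mapping_eq_iff fun_eq_iff)
  have app: "?l (append_coord m (z, t)) i = (if i = m then ?l z m + t else ?l z i)" for z t i
    by (auto simp: append_coord_def lookup_add lookup_single when_def)
  show ?case
  proof (intro iffI; (elim conjE)?)
    assume "y \<in> lex_cone (Suc m)"
    then obtain z t where y: "y = append_coord m (z, t)"
      and zt: "z \<in> lex_cone m \<and> z \<noteq> 0 \<or> z = 0 \<and> t \<ge> 0"
      by (auto simp: lex_prod_cone_def)
    have K: "?l z i = 0" if "i \<ge> m" for i
      using zt Suc that keys by auto
    have "Poly_Mapping.keys y \<subseteq> {..<Suc m}"
      unfolding keys using K by (auto simp: y app)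
    moreover have "y = 0 \<or> (\<exists>k<Suc m. (\<forall>i<k. ?l y i = 0) \<and> 0 < ?l y k)"
    proof (cases "z = 0")
      case True
      then show ?thesis
        using zt unfolding eq0 y app
        by (cases "t = 0") (auto intro!: exI[of _ m])
    next
      case False
      then obtain k where "k < m" "\<forall>i<k. ?l z i = 0" "0 < ?l z k"
        using zt Suc by auto
      then show ?thesis
        unfolding y app by (intro disjI2 exI[of _ k]) auto
    qed
    ultimately show "Poly_Mapping.keys y \<subseteq> {..<Suc m} \<and>
        (y = 0 \<or> (\<exists>k<Suc m. (\<forall>i<k. ?l y i = 0) \<and> 0 < ?l y k))" by blast
  next
    assume ky: "Poly_Mapping.keys y \<subseteq> {..<Suc m}"
      and y: "y = 0 \<or> (\<exists>k<Suc m. (\<forall>i<k. ?l y i = 0) \<and> 0 < ?l y k)"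
    define z where "z = append_coord m (y, - ?l y m)"
    have lz: "?l z i = (if i = m then 0 else ?l y i)" for i
      by (simp add: z_def app)
    have yz: "y = append_coord m (z, ?l y m)"
      by (auto simp: poly_mapping_eq_iff fun_eq_iff app lz)
    have kz: "Poly_Mapping.keys z \<subseteq> {..<m}"
      using ky by (auto simp: keys lz)
    have "(z, ?l y m) \<in> lex_prod_cone (lex_cone m) {0..}"
    proof (cases "z = 0")
      case True
      have "\<exists>k<Suc m. (\<forall>i<k. ?l y i = 0) \<and> 0 < ?l y k \<Longrightarrow> 0 \<le> ?l y m"
        using True lz by (metis less_eq_real_def lookup_zero order_less_irrefl)
      then show ?thesis
        using True y by (auto simp: lex_prod_cone_def)
    next
      case False
      then obtain k where k: "k < Suc m" "\<forall>i<k. ?l y i = 0" "0 < ?l y k"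
        using y by (auto simp: eq0 lz split: if_splits)
      have "k \<noteq> m"
        using False k kz by (auto simp: eq0 lz keys) (metis linorder_neqE_nat nat_less_le)
      then have "z \<in> lex_cone m"
        using k kz by (auto simp: Suc lz intro!: exI[of _ k])
      then show ?thesis
        using False by (auto simp: lex_prod_cone_def)
    qed
    then show "y \<in> lex_cone (Suc m)"
      using yz by auto
  qed
qed

lemma lookup_scaleR: "Poly_Mapping.lookup (c *\<^sub>R y) i = c * Poly_Mapping.lookup y i"
  for y :: "nat \<Rightarrow>\<^sub>0 real"
proof -
  have "finite {i. c * Poly_Mapping.lookup y i \<noteq> 0}"
    by (rule finite_subset[OF _ finite_lookup[of y]]) auto
  then show ?thesis
    by (simp add: scaleR_poly_mapping_def)
qed

lemma pointed_convex_cone_lex_cone: "pointed_convex_cone (lex_cone m)"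
proof -
  let ?l = "Poly_Mapping.lookup :: (nat \<Rightarrow>\<^sub>0 real) \<Rightarrow> _"
  have keys: "Poly_Mapping.keys z \<subseteq> {..<n} \<longleftrightarrow> (\<forall>i\<ge>n. ?l z i = 0)" for z n
    by (auto simp: in_keys_iff subset_iff) (meson leI)
  have zero: "0 \<in> lex_cone m"
    by (simp add: lex_cone_iff)
  have add: "x + y \<in> lex_cone m" if xy: "x \<in> lex_cone m" "y \<in> lex_cone m" for x y
  proof (cases "x = 0 \<or> y = 0")
    case True
    then show ?thesis using that by auto
  next
    case False
    then obtain j k where j: "j < m" "\<forall>i<j. ?l x i = 0" "0 < ?l x j"
      and k: "k < m" "\<forall>i<k. ?l y i = 0" "0 < ?l y k"
      using xy by (auto simp: lex_cone_iff)
    have "(\<forall>i<min j k. ?l (x + y) i = 0) \<and> 0 < ?l (x + y) (min j k)"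
      using j k by (cases j k rule: linorder_cases) (auto simp: lookup_add)
    moreover have "min j k < m" using j by auto
    moreover have "Poly_Mapping.keys (x + y) \<subseteq> {..<m}"
      using that by (auto simp: lex_cone_iff keys lookup_add)
    ultimately show ?thesis by (auto simp: lex_cone_iff)
  qed
  have scale: "c *\<^sub>R x \<in> lex_cone m" if "x \<in> lex_cone m" "c \<ge> 0" for x c
  proof (cases "c = 0 \<or> x = 0")
    case True
    then show ?thesis using zero by auto
  next
    case False
    then have "c > 0" using that by auto
    then show ?thesis
      using that False by (auto simp: lex_cone_iff keys lookup_scaleR zero_less_mult_iff)
  qed
  have pointed: "x = 0" if xm: "x \<in> lex_cone m" "- x \<in> lex_cone m" for x
  proof (rule ccontr)
    assume "x \<noteq> 0"
    then obtain j k where j: "\<forall>i<j. ?l x i = 0" "0 < ?l x j"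
      and k: "\<forall>i<k. ?l x i = 0" "?l x k < 0"
      using xm by (auto simp: lex_cone_iff)
    then show False by (cases j k rule: linorder_cases) auto
  qed
  have "lex_cone m \<inter> uminus ` lex_cone m = {0}"
  proof
    show "lex_cone m \<inter> uminus ` lex_cone m \<subseteq> {0}"
      using pointed by auto
    show "{0} \<subseteq> lex_cone m \<inter> uminus ` lex_cone m"
      using zero by (auto intro: image_eqI[of _ _ 0])
  qed
  then show ?thesis
    unfolding pointed_convex_cone_def convex_cone_iff using zero add scale by blast
qed

lemma affine_lex_map_imp_oriented:
  assumes "affine_lex_map \<phi> K"
  shows "oriented_affine_map \<phi> K"
proof -
  from assms obtain m \<psi> where aff: "\<forall>i<m. affine_map (\<psi> i)"
    and eq: "\<phi> = lex_map \<psi> m" "K = lex_cone m"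
    unfolding affine_lex_map_def by blast
  have "affine_map (lex_map \<psi> m)" using aff
  proof (induction m)
    case 0
    show ?case
      unfolding affine_map_def
      by (intro exI[of _ "\<lambda>_. 0"] exI[of _ 0]) (auto intro: linearI)
  next
    case (Suc m)
    then obtain g c h d where g: "linear g" "lex_map \<psi> m = (\<lambda>x. g x + c)"
      and h: "linear h" "\<psi> m = (\<lambda>x. h x + d)"
      unfolding affine_map_def by auto
    have single: "linear (Poly_Mapping.single m :: real \<Rightarrow> _)"
      by (rule linearI) (auto simp: poly_mapping_eq_iff fun_eq_iff lookup_add lookup_scaleR
          lookup_single when_def)
    have "linear (\<lambda>x. g x + Poly_Mapping.single m (h x))"
      using g(1) linear_compose[OF h(1) single] by (intro linear_compose_add) (auto simp: o_def)
    then show ?case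
      unfolding affine_map_def
      by (intro exI[of _ "\<lambda>x. g x + Poly_Mapping.single m (h x)"]
                exI[of _ "c + Poly_Mapping.single m d"])
         (auto simp: g(2) h(2) append_coord_def lex_prod_map_def single_add fun_eq_iff)
  qed
  then show ?thesis
    unfolding oriented_affine_map_def eq using pointed_convex_cone_lex_cone by blast
qed

end

theory Submission
  imports Defs
begin

text \<open>
  If \<open>F = C \<inter> ker f\<close> is non-empty, then \<open>range f\<close> is a finite-dimensional linear subspace \<open>W\<close> of
  the codomain, and the elements of the pointed cone \<open>K\<close> lying in \<open>W\<close> can be made
  lexicographically positive: as long as \<open>W \<noteq> {0}\<close>, the cone \<open>K \<inter> W\<close> has a non-zero supporting
  functional on \<open>W\<close> (M. Riesz extension), and one continues with its kernel. Composing these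
  functionals with \<open>f\<close> gives the lexicographic map.
\<close>

section \<open>Separation and extension of linear functionals\<close>

text \<open>A basis of \<open>V\<close> stays independent when \<open>w\<close> is added, so values
  on the enlarged basis can be prescribed freely.\<close>

lemma linear_functional_separating:
  fixes V :: "'b::real_vector set"
  assumes "subspace V" "w \<notin> V"
  obtains h :: "'b \<Rightarrow> real" where "linear h" "\<And>v. v \<in> V \<Longrightarrow> h v = 0" "h w = 1"
proof -
  obtain B where B: "B \<subseteq> V" "independent B" "V \<subseteq> span B"
    using maximal_independent_subset by blast
  then have "span B = V"
    using assms(1) by (simp add: span_subspace)
  then have "independent (insert w B)"
    using B assms(2) by (simp add: independent_insert)
  then obtain h :: "'b \<Rightarrow> real"
    where h: "linear h" "\<forall>x\<in>insert w B. h x = (if x = w then 1 else 0)"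
    using linear_independent_extend[of "insert w B" "\<lambda>x. if x = w then 1 else 0"] by blast
  have "h v = 0" if "v \<in> V" for v
  proof (rule linear_eq_0_on_span[OF h(1)])
    show "v \<in> span B" using that B by blast
    show "h b = 0" if "b \<in> B" for b using h(2) that B(1) assms(2) by auto
  qed
  then show thesis using h that by auto
qed

text \<open>The extension is determined by its value \<open>c\<close> at \<open>w\<close>.
  Positivity forces \<open>l v \<le> c \<le> l u\<close> whenever \<open>w - v\<close> and
  \<open>u - w\<close> lie in \<open>P\<close>, with \<open>u\<close> and \<open>v\<close> in
  \<open>V\<close>. The supremum of the lower bounds is such a \<open>c\<close>: the two conditions
  relating \<open>e\<close> and \<open>w\<close> make this set of bounds non-empty and bounded
  above.\<close>

lemma Riesz_extension_step:
  fixes P :: "'b::real_vector set"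
  assumes P: "convex_cone P" and V: "subspace V" "e \<in> V"
    and l: "linear (l :: 'b \<Rightarrow> real)" "\<And>v. v \<in> P \<inter> V \<Longrightarrow> 0 \<le> l v"
    and w: "w \<notin> V" "s *\<^sub>R e + w \<in> P" "t *\<^sub>R e - w \<in> P"
  obtains l' :: "'b \<Rightarrow> real" where "linear l'" "\<And>v. v \<in> V \<Longrightarrow> l' v = l v"
    "\<And>v. v \<in> P \<inter> span (insert w V) \<Longrightarrow> 0 \<le> l' v"
proof -
  note add = convex_cone_iff[THEN iffD1, OF P, THEN conjunct2, THEN conjunct1, rule_format]
  note scale = convex_cone_iff[THEN iffD1, OF P, THEN conjunct2, THEN conjunct2, rule_format]
  interpret l: linear l by fact
  define L where "L = l ` {v \<in> V. w - v \<in> P}"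
  define c where "c = Sup L"
  have le: "l v \<le> l u" if "v \<in> V" "w - v \<in> P" "u \<in> V" "u - w \<in> P" for u v
  proof -
    have "(u - w) + (w - v) \<in> P" using add that by blast
    then have "u - v \<in> P \<inter> V" using that V by (auto simp: subspace_diff)
    then show ?thesis using l(2)[of "u - v"] by (simp add: l.diff)
  qed
  have "(- s) *\<^sub>R e \<in> V" "w - (- s) *\<^sub>R e \<in> P"
    using V w by (auto simp: subspace_scale subspace_neg add.commute)
  then have "L \<noteq> {}" unfolding L_def by blast
  have "t *\<^sub>R e \<in> V" using V by (simp add: subspace_scale)
  then have "bdd_above L"
    using le w(3) by (auto simp: L_def intro!: bdd_aboveI[of _ "l (t *\<^sub>R e)"])
  have lower: "l v \<le> c" if "v \<in> V" "w - v \<in> P" for v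
    unfolding c_def using that \<open>bdd_above L\<close> by (auto simp: L_def intro!: cSup_upper)
  have upper: "c \<le> l u" if "u \<in> V" "u - w \<in> P" for u
    unfolding c_def using that \<open>L \<noteq> {}\<close> le by (intro cSup_least) (auto simp: L_def)
  obtain h :: "'b \<Rightarrow> real" where h: "linear h" "\<And>v. v \<in> V \<Longrightarrow> h v = 0" "h w = 1"
    using linear_functional_separating[OF V(1) w(1)] by blast
  interpret h: linear h by fact
  \<comment> \<open>Since \<open>l\<close> is total, it already has a value at \<open>w\<close>; the
    multiple of \<open>h\<close> changes this value to \<open>c\<close> and leaves \<open>V\<close>
    untouched.\<close>
  define l' where "l' = (\<lambda>v. l v + (c - l w) * h v)"
  have "linear l'"
    unfolding l'_def
    by (intro linearI) (auto simp: l.add h.add l.scale h.scale algebra_simps)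
  moreover have "l' v = l v" if "v \<in> V" for v
    using that h by (simp add: l'_def)
  moreover have "0 \<le> l' v" if v: "v \<in> P \<inter> span (insert w V)" for v
  proof -
    obtain k where "v - k *\<^sub>R w \<in> span V" using v by (auto simp: span_insert)
    then have k: "v - k *\<^sub>R w \<in> V" by (simp add: span_eq_iff[THEN iffD2, OF V(1)])
    define u where "u = v - k *\<^sub>R w"
    have u: "u \<in> V" "v = u + k *\<^sub>R w" using k by (auto simp: u_def)
    have l'v: "l' v = l u + k * c"
      using u h by (simp add: l'_def l.add h.add l.scale h.scale algebra_simps)
    \<comment> \<open>Dividing \<open>v\<close> by the absolute value of \<open>k\<close> gives the
      form \<open>w - v'\<close> or \<open>u' - w\<close>, to which the lower or upper bound on
      \<open>c\<close> applies.\<close>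
    consider "k = 0" | "k > 0" | "k < 0" by linarith
    then show ?thesis
    proof cases
      case 1
      then show ?thesis using l'v u v l(2) by auto
    next
      case 2
      have "(1 / k) *\<^sub>R v \<in> P" using v 2 scale by auto
      also have "(1 / k) *\<^sub>R v = w - (- 1 / k) *\<^sub>R u"
        using 2 u by (simp add: scaleR_add_right)
      finally have "l ((- 1 / k) *\<^sub>R u) \<le> c"
        using u V by (intro lower) (auto simp: subspace_scale subspace_neg)
      then show ?thesis using 2 l'v by (simp add: l.scale l.neg field_simps)
    next
      case 3
      have "(- 1 / k) *\<^sub>R v \<in> P" using v 3 scale[of v "- 1 / k"] by (auto simp: divide_simps)
      also have "(- 1 / k) *\<^sub>R v = (- 1 / k) *\<^sub>R u - w"
        using 3 u by (simp add: scaleR_add_right)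
      finally have "c \<le> l ((- 1 / k) *\<^sub>R u)"
        using u V by (intro upper) (auto simp: subspace_scale subspace_neg)
      then show ?thesis using 3 l'v by (simp add: l.scale l.neg field_simps)
    qed
  qed
  ultimately show thesis using that by blast
qed

text \<open>The functional is built one generator at a time, starting on the line through
  \<open>e\<close>. There it is non-negative on \<open>P\<close> because a negative multiple of
  \<open>e\<close> in \<open>P\<close> could be rescaled to \<open>- e\<close>.\<close>

lemma Riesz_extension:
  fixes P :: "'b::real_vector set"
  assumes P: "convex_cone P" "- e \<notin> P"
    and "finite S" "\<And>w. w \<in> S \<Longrightarrow> \<exists>s. s *\<^sub>R e + w \<in> P" "\<And>w. w \<in> S \<Longrightarrow> \<exists>t. t *\<^sub>R e - w \<in> P"
  shows "\<exists>l :: 'b \<Rightarrow> real. linear l \<and> l e = 1 \<and> (\<forall>v \<in> P \<inter> span (insert e S). 0 \<le> l v)"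
  using assms(3-)
proof (induction S)
  case empty
  have "e \<notin> {0}" using P by (auto simp: convex_cone_iff)
  then obtain l :: "'b \<Rightarrow> real" where l: "linear l" "l e = 1"
    using linear_functional_separating[OF subspace_single_0, of e] by metis
  have "0 \<le> l v" if v: "v \<in> P" "v = k *\<^sub>R e" for v k
  proof (rule ccontr)
    assume "\<not> 0 \<le> l v"
    then have "k < 0" using l v by (simp add: linear_scale)
    then have "0 \<le> - 1 / k" by (simp add: divide_simps)
    then have "(- 1 / k) *\<^sub>R v \<in> P"
      using v(1) P(1) unfolding convex_cone_iff by blast
    moreover have "(- 1 / k) *\<^sub>R v = - e" using v(2) \<open>k < 0\<close> by simp
    ultimately show False using P(2) by simp
  qed
  then show ?case using l by (auto simp: span_singleton)
next
  case (insert w S)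
  then obtain l :: "'b \<Rightarrow> real"
    where l: "linear l" "l e = 1" "\<And>v. v \<in> P \<inter> span (insert e S) \<Longrightarrow> 0 \<le> l v"
    by auto
  have swap: "insert e (insert w S) = insert w (insert e S)" by auto
  show ?case
  proof (cases "w \<in> span (insert e S)")
    case True
    then show ?thesis using l by (auto simp: swap span_redundant)
  next
    case False
    obtain s t where "s *\<^sub>R e + w \<in> P" "t *\<^sub>R e - w \<in> P" using insert.prems by blast
    then obtain l' :: "'b \<Rightarrow> real" where l': "linear l'" "l' e = l e"
      "\<And>v. v \<in> P \<inter> span (insert w (span (insert e S))) \<Longrightarrow> 0 \<le> l' v"
      using Riesz_extension_step[OF P(1) subspace_span _ l(1,3) False]
      by (metis insertI1 span_base)
    have "span (insert w (insert e S)) \<subseteq> span (insert w (span (insert e S)))"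
      by (intro span_mono) (auto intro: span_base)
    then show ?thesis using l l' by (intro exI[of _ l']) (auto simp: swap)
  qed
qed

section \<open>Supporting functionals of pointed cones\<close>

text \<open>For a single \<open>s = p - q\<close> the element \<open>p + q\<close> works, as adding
  or subtracting \<open>s\<close> gives \<open>p + p\<close> or \<open>q + q\<close>. For several
  elements, such sums are added up. This provides the element \<open>e\<close> that the extension
  argument requires.\<close>

lemma convex_cone_dominating_element:
  assumes Q: "convex_cone Q" and "finite S" "S \<subseteq> {p - q |p q. p \<in> Q \<and> q \<in> Q}"
  shows "\<exists>e \<in> Q. \<forall>s \<in> S. e + s \<in> Q \<and> e - s \<in> Q"
  using assms(2,3)
proof (induction S)
  case empty
  then show ?case using Q by (auto simp: convex_cone_iff)
next
  case (insert s S)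
  note add = convex_cone_iff[THEN iffD1, OF Q, THEN conjunct2, THEN conjunct1, rule_format]
  obtain e where e: "e \<in> Q" "\<And>s. s \<in> S \<Longrightarrow> e + s \<in> Q \<and> e - s \<in> Q"
    using insert by auto
  obtain p q where pq: "s = p - q" "p \<in> Q" "q \<in> Q" using insert.prems by blast
  have "(p + q + e) + r \<in> Q \<and> (p + q + e) - r \<in> Q" if "r \<in> insert s S" for r
  proof (cases "r = s")
    case True
    then have "(p + q + e) + r = p + p + e" "(p + q + e) - r = q + q + e"
      using pq by (auto simp: algebra_simps)
    then show ?thesis using pq e add by metis
  next
    case False
    then have "p + q + (e + r) \<in> Q" "p + q + (e - r) \<in> Q" using that e pq add by auto
    then show ?thesis by (simp add: algebra_simps)
  qed
  moreover have "p + q + e \<in> Q" using pq e by (intro add conjI)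
  ultimately show ?case by blast
qed

text \<open>If differences of elements of \<open>K \<inter> span B\<close> fill
  \<open>span B\<close>, a dominating element exists and Riesz extension applies. Otherwise these
  differences form a proper subspace, and a functional vanishing on it will do. The witness of
  non-vanishing is taken from \<open>B\<close> so that it can serve as the generator to eliminate in
  an induction.\<close>

lemma pointed_cone_supporting_functional:
  fixes K :: "'b::real_vector set"
  assumes K: "pointed_convex_cone K" and B: "finite B" "\<not> span B \<subseteq> {0}"
  obtains l :: "'b \<Rightarrow> real" and b where "linear l" "b \<in> B" "l b \<noteq> 0"
    "\<And>v. v \<in> K \<inter> span B \<Longrightarrow> 0 \<le> l v"
proof -
  define Q where "Q = K \<inter> span B"
  have Q: "convex_cone Q"
    using K unfolding Q_def pointed_convex_cone_def convex_cone_iff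
    by (auto simp: span_add span_scale span_zero)
  have pointed: "v = 0" if "v \<in> Q" "- v \<in> Q" for v
    using K that unfolding Q_def pointed_convex_cone_def
    by (metis IntD1 IntI add.inverse_inverse imageI singletonD)
  define U where "U = {p - q |p q. p \<in> Q \<and> q \<in> Q}"
  show thesis
  proof (cases "B \<subseteq> U")
    case True
    then obtain e where e: "e \<in> Q" "\<And>b. b \<in> B \<Longrightarrow> e + b \<in> Q \<and> e - b \<in> Q"
      using convex_cone_dominating_element[OF Q B(1)] unfolding U_def by blast
    obtain b where b: "b \<in> B" "b \<noteq> 0"
      using B(2) span_mono[of B "{0}"] by auto
    \<comment> \<open>Otherwise \<open>e = 0\<close> by pointedness; then \<open>b\<close> and
      \<open>- b\<close> both lie in \<open>Q\<close>, which forces \<open>b = 0\<close>.\<close>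
    have "- e \<notin> Q"
      using pointed[of e] pointed[of b] e b by auto
    moreover have "\<exists>s. s *\<^sub>R e + b \<in> Q" "\<exists>t. t *\<^sub>R e - b \<in> Q" if "b \<in> B" for b
      using e(2)[OF that] by (metis scaleR_one)+
    ultimately obtain l :: "'b \<Rightarrow> real" where l: "linear l" "l e = 1"
      "\<And>v. v \<in> Q \<inter> span (insert e B) \<Longrightarrow> 0 \<le> l v"
      using Riesz_extension[OF Q _ B(1)] by metis
    have "0 \<le> l v" if "v \<in> K \<inter> span B" for v
      using l(3)[of v] that span_mono[of B "insert e B"] by (auto simp: Q_def)
    \<comment> \<open>If \<open>l\<close> vanished on \<open>B\<close>, it would vanish at
      \<open>e\<close>, which lies in \<open>span B\<close>.\<close>
    moreover have "\<exists>b\<in>B. l b \<noteq> 0"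
      using linear_eq_0_on_span[OF l(1), of B e] e(1) l(2) by (auto simp: Q_def)
    ultimately show thesis using that l(1) by blast
  next
    case False
    then obtain b where b: "b \<in> B" "b \<notin> U" by blast
    have U: "subspace U"
    proof (intro subspaceI)
      show "0 \<in> U" using Q by (force simp: U_def convex_cone_iff)
      show "x + y \<in> U" if xy: "x \<in> U" "y \<in> U" for x y
      proof -
        obtain p q p' q' where pq: "x = p - q" "y = p' - q'" "p \<in> Q" "q \<in> Q" "p' \<in> Q" "q' \<in> Q"
          using xy unfolding U_def by blast
        then have "x + y = (p + p') - (q + q')" "p + p' \<in> Q" "q + q' \<in> Q"
          using Q by (auto simp: convex_cone_iff)
        then show ?thesis unfolding U_def by blast
      qed
      show "c *\<^sub>R x \<in> U" if x: "x \<in> U" for c x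
      proof -
        obtain p q where pq: "x = p - q" "p \<in> Q" "q \<in> Q"
          using x unfolding U_def by blast
        \<comment> \<open>The sign of \<open>c\<close> decides which of the two differences has
          non-negative coefficients.\<close>
        have "c *\<^sub>R x = c *\<^sub>R p - c *\<^sub>R q" "c *\<^sub>R x = (- c) *\<^sub>R q - (- c) *\<^sub>R p"
          using pq by (auto simp: scaleR_diff_right)
        moreover have "r *\<^sub>R p \<in> Q \<and> r *\<^sub>R q \<in> Q" if "0 \<le> r" for r
          using pq Q that by (auto simp: convex_cone_iff)
        ultimately show ?thesis
          unfolding U_def by (smt (verit) mem_Collect_eq)
      qed
    qed
    obtain l :: "'b \<Rightarrow> real" where l: "linear l" "\<And>v. v \<in> U \<Longrightarrow> l v = 0" "l b = 1"
      using linear_functional_separating[OF U b(2)] by blast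
    have "Q \<subseteq> U" using Q by (force simp: U_def convex_cone_iff)
    then have "l v = 0" if "v \<in> K \<inter> span B" for v
      using l(2) that by (auto simp: Q_def)
    then show thesis using that l b by (metis order_refl zero_neq_one)
  qed
qed

section \<open>Lexicographic positivity of a pointed cone\<close>

text \<open>A supporting functional comes first in the list. Cone elements where it is positive are
  settled; the others lie in its kernel, which is spanned by fewer generators, so induction applies.
  The non-vanishing condition in the first conjunct is what later makes the affine functionals
  non-constant on the preceding kernels.\<close>

lemma pointed_cone_lex_functionals:
  fixes K :: "'b::real_vector set"
  assumes K: "pointed_convex_cone K" and "finite B"
  shows "\<exists>(m::nat) (l :: nat \<Rightarrow> 'b \<Rightarrow> real).
    (\<forall>i<m. linear (l i) \<and> (\<exists>x\<in>span B. (\<forall>j<i. l j x = 0) \<and> l i x \<noteq> 0)) \<and>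
    (\<forall>x\<in>K \<inter> span B. x = 0 \<or> (\<exists>k<m. (\<forall>j<k. l j x = 0) \<and> 0 < l k x))"
  using assms(2)
proof (induction "card B" arbitrary: B rule: less_induct)
  case less
  show ?case
  proof (cases "span B \<subseteq> {0}")
    case True
    then show ?thesis by (intro exI[of _ 0]) auto
  next
    case False
    obtain f :: "'b \<Rightarrow> real" and b where f: "linear f" "b \<in> B" "f b \<noteq> 0"
      "\<And>v. v \<in> K \<inter> span B \<Longrightarrow> 0 \<le> f v"
      using pointed_cone_supporting_functional[OF K less.prems False] by blast
    interpret f: linear f by fact
    \<comment> \<open>The projection along \<open>b\<close> onto the kernel of \<open>f\<close>. It
      maps \<open>span B\<close> onto \<open>span B \<inter> ker f\<close> and kills
      \<open>b\<close>, so the images of the remaining generators span this kernel.\<close>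
    define p where "p = (\<lambda>x. x - (f x / f b) *\<^sub>R b)"
    have p: "linear p"
      unfolding p_def
      by (intro linearI) (auto simp: f.add f.scale algebra_simps add_divide_distrib)
    define B' where "B' = p ` (B - {b})"
    have "p b = 0" using f by (simp add: p_def)
    have "insert b (B - {b}) = B" using f by auto
    then have "p ` B = insert 0 B'"
      using \<open>p b = 0\<close> by (metis B'_def image_insert)
    then have span_B': "span B' = p ` span B"
      using span_linear_image[OF p, of B] by (simp add: span_insert_0)
    have sub: "span B' \<subseteq> span B"
      unfolding span_B' using span_base[OF f(2)] by (auto simp: p_def intro!: span_diff span_scale)
    have ker: "f x = 0" if "x \<in> span B'" for x
      using that f(3) unfolding span_B' by (auto simp: p_def f.diff f.scale)
    have in_B': "x \<in> span B'" if "x \<in> span B" "f x = 0" for x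
      using that unfolding span_B' by (auto simp: p_def intro!: image_eqI[of _ _ x])
    have card_B': "card B' < card B"
      unfolding B'_def using less.prems f(2)
      by (meson card_Diff1_less card_image_le finite_Diff le_less_trans)
    have finite_B': "finite B'" using less.prems by (simp add: B'_def)
    obtain m and l :: "nat \<Rightarrow> 'b \<Rightarrow> real" where
      l: "\<forall>i<m. linear (l i) \<and> (\<exists>x\<in>span B'. (\<forall>j<i. l j x = 0) \<and> l i x \<noteq> 0)"
      and pos: "\<forall>x\<in>K \<inter> span B'. x = 0 \<or> (\<exists>k<m. (\<forall>j<k. l j x = 0) \<and> 0 < l k x)"
      using less.hyps[OF card_B' finite_B'] by (elim exE conjE) (rule that)
    define l' where "l' = case_nat f l"
    have l'_simps: "l' 0 = f" "l' (Suc i) = l i" for i by (auto simp: l'_def)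
    show ?thesis
    proof (intro exI[of _ "Suc m"] exI[of _ l'] conjI allI impI ballI)
      fix i assume i: "i < Suc m"
      show "linear (l' i)" using f l i by (cases i) (auto simp: l'_simps)
      show "\<exists>x\<in>span B. (\<forall>j<i. l' j x = 0) \<and> l' i x \<noteq> 0"
      proof (cases i)
        case 0
        then show ?thesis using f by (auto simp: l'_simps intro: span_base)
      next
        case (Suc n)
        then obtain x where "x \<in> span B'" "\<forall>j<n. l j x = 0" "l n x \<noteq> 0"
          using l i by auto
        then show ?thesis
          using sub ker Suc by (intro bexI[of _ x]) (auto simp: l'_simps less_Suc_eq_0_disj)
      qed
    next
      fix x assume x: "x \<in> K \<inter> span B"
      show "x = 0 \<or> (\<exists>k<Suc m. (\<forall>j<k. l' j x = 0) \<and> 0 < l' k x)"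
      proof (cases "f x = 0")
        case False
        then have "0 < f x" using f(4)[OF x] by simp
        then show ?thesis by (auto simp: l'_simps intro!: exI[of _ 0])
      next
        case True
        then have "x = 0 \<or> (\<exists>k<m. (\<forall>j<k. l j x = 0) \<and> 0 < l k x)"
          using x in_B' pos by auto
        then show ?thesis
        proof (elim disjE exE conjE)
          fix k assume "k < m" "\<forall>j<k. l j x = 0" "0 < l k x"
          then show ?thesis
            using True by (intro disjI2 exI[of _ "Suc k"]) (auto simp: l'_simps less_Suc_eq_0_disj)
        qed simp
      qed
    qed
  qed
qed

section \<open>The lexicographic map of a face\<close>

theorem corollary6p9:
  fixes C F :: "'a::real_vector set"
  assumes "\<exists>B :: 'a set. finite B \<and> span B = UNIV"
    and "convex C"
    and "is_face TYPE('b::real_vector) C F"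
    and "F \<noteq> {}"
  shows "\<exists>\<phi> K. affine_lex_map \<phi> K \<and> \<phi> ` C \<subseteq> K \<and> F = C \<inter> affine_ker \<phi>"
proof -
  obtain f :: "'a \<Rightarrow> 'b" and K where f: "affine_map f" and K: "pointed_convex_cone K"
    and fC: "f ` C \<subseteq> K" and F: "F = C \<inter> affine_ker f"
    using assms(3) unfolding is_face_def oriented_affine_map_def by blast
  obtain g c where g: "linear g" "f = (\<lambda>x. g x + c)" using f unfolding affine_map_def by blast
  interpret g: linear g by fact
  obtain x0 where "x0 \<in> F" using assms(4) by blast
  then have x0: "g x0 + c = 0" using F g(2) by (auto simp: affine_ker_def)
  obtain B :: "'a set" where B: "finite B" "span B = UNIV" using assms(1) by blast
  have range_g: "span (g ` B) = range g" using span_linear_image[OF g(1), of B] B by simp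
  \<comment> \<open>Non-emptiness of the face enters here: as \<open>f\<close> vanishes at
    \<open>x0\<close>, its values lie in the linear range of \<open>g\<close>, not merely in a
    translate of it.\<close>
  have "f x = g (x - x0)" for x
    using x0 by (simp add: g(2) g.diff add_eq_0_iff)
  then have f_range: "f x \<in> span (g ` B)" for x unfolding range_g by auto
  obtain m and l :: "nat \<Rightarrow> 'b \<Rightarrow> real" where
    lex: "\<forall>i<m. linear (l i) \<and> (\<exists>x\<in>span (g ` B). (\<forall>j<i. l j x = 0) \<and> l i x \<noteq> 0)"
    and pos: "\<forall>x\<in>K \<inter> span (g ` B). x = 0 \<or> (\<exists>k<m. (\<forall>j<k. l j x = 0) \<and> 0 < l k x)"
    using pointed_cone_lex_functionals[OF K finite_imageI[OF B(1), of g]]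
    by (elim exE conjE) (rule that)
  have l: "linear (l i)" "\<exists>x\<in>span (g ` B). (\<forall>j<i. l j x = 0) \<and> l i x \<noteq> 0" if "i < m" for i
    using lex that by auto
  define \<psi> where "\<psi> = (\<lambda>i x. l i (f x))"
  have "affine_map (\<psi> i)" if "i < m" for i
    unfolding affine_map_def
  proof (intro exI conjI)
    show "linear (l i \<circ> g)" using l(1)[OF that] g(1) linear_compose by blast
    show "\<psi> i = (\<lambda>x. (l i \<circ> g) x + l i c)"
      using linear_add[OF l(1)[OF that]] by (simp add: \<psi>_def g(2))
  qed
  moreover have "\<not> \<psi> i constant_on (\<Inter>j<i. affine_ker (\<psi> j))" if i: "i < m" for i
  proof
    assume const: "\<psi> i constant_on (\<Inter>j<i. affine_ker (\<psi> j))"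
    obtain z where z: "\<forall>j<i. l j (g z) = 0" "l i (g z) \<noteq> 0"
      using l(2)[OF i] unfolding range_g by auto
    \<comment> \<open>Translation by \<open>x0\<close> carries the linear witness \<open>z\<close>
      to the affine setting: \<open>x0\<close> and \<open>z + x0\<close> both lie in the preceding
      kernels, but \<open>\<psi> i\<close> vanishes only at the former.\<close>
    have fz: "f (z + x0) = g z" using x0 by (simp add: g(2) g.add add.assoc)
    have "f x0 = 0" using x0 by (simp add: g(2))
    then have zero: "\<psi> j x0 = 0" if "j < m" for j
      using l(1)[OF that] by (simp add: \<psi>_def linear_0)
    have "x0 \<in> (\<Inter>j<i. affine_ker (\<psi> j))" using zero i by (auto simp: affine_ker_def)
    moreover have "z + x0 \<in> (\<Inter>j<i. affine_ker (\<psi> j))"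
      using z fz by (auto simp: affine_ker_def \<psi>_def)
    ultimately have "\<psi> i (z + x0) = \<psi> i x0"
      using const unfolding constant_on_def by metis
    then show False using zero[OF i] z fz by (simp add: \<psi>_def)
  qed
  ultimately have "affine_lex_map (lex_map \<psi> m) (lex_cone m)"
    unfolding affine_lex_map_def by blast
  moreover have "lex_map \<psi> m x \<in> lex_cone m" if "x \<in> C" for x
  proof -
    have "f x = 0 \<or> (\<exists>k<m. (\<forall>j<k. l j (f x) = 0) \<and> 0 < l k (f x))"
      using pos fC f_range that by blast
    moreover have "lex_map \<psi> m x = 0" if "f x = 0"
      using that l(1)
      by (auto simp: poly_mapping_eq_iff fun_eq_iff lookup_lex_map \<psi>_def linear_0)
    moreover have "Poly_Mapping.keys (lex_map \<psi> m x) \<subseteq> {..<m}"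
      by (auto simp: in_keys_iff lookup_lex_map split: if_splits)
    ultimately show ?thesis
      unfolding lex_cone_iff by (auto simp: lookup_lex_map \<psi>_def)
  qed
  moreover have "x \<in> affine_ker f \<longleftrightarrow> x \<in> affine_ker (lex_map \<psi> m)" if "x \<in> C" for x
  proof
    show "x \<in> affine_ker (lex_map \<psi> m)" if "x \<in> affine_ker f"
      using that l(1) unfolding affine_ker_lex_map by (auto simp: affine_ker_def \<psi>_def linear_0)
    assume "x \<in> affine_ker (lex_map \<psi> m)"
    then have "\<forall>i<m. l i (f x) = 0"
      unfolding affine_ker_lex_map by (auto simp: affine_ker_def \<psi>_def)
    moreover have "f x \<in> K \<inter> span (g ` B)"
      using fC f_range \<open>x \<in> C\<close> by blast
    \<comment> \<open>With all \<open>l k (f x)\<close> equal to zero, no first positive coordinate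
      can exist, which leaves only the other alternative in \<open>pos\<close>.\<close>
    ultimately have "f x = 0"
      using pos by (metis less_irrefl)
    then show "x \<in> affine_ker f" by (simp add: affine_ker_def)
  qed
  ultimately show ?thesis
    unfolding F by blast
qed

end
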